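(* Let $0<\alpha<2$, $n>\alpha$, $\lambda_0>0$, and let $\Omega\subset B_{\lambda_0}^c(0)$ be an open set. Suppose that $h\in\mathcal{L}_\alpha\cap C^{1,1}_{loc}(\Omega)$ is lower semicontinuous on $\bar\Omega$ and satisfies $$\begin{cases}(-\Delta)^{\alpha/2}h(x)\ge 0 & \text{in }\Omega,\\ h(x)\ge 0 & \text{in } B_{\lambda_0}^c(0)\setminus\Omega,\\ h(x)=-\left(\frac{\lambda_0}{|x|}\right)^{n-\alpha}h\left(\frac{\lambda_0^2x}{|x|^2}\right) & \text{in } B_{\lambda_0}^c(0).\end{cases}$$ If $\liminf_{|x|\to\infty}h(x)\ge 0$, then $h(x)\ge 0$ in $\Omega$.
   Context: The fractional Laplacian is $(-\Delta)^{\alpha/2}u(x)=C_{n,\alpha}\,\mathrm{P.V.}\int_{\mathbb{R}^n}\frac{u(x)-u(z)}{|x-z|^{n+\alpha}}\,dz$, where $\mathrm{P.V.}$ is the Cauchy principal value and $C_{n,\alpha}>0$ is a normalization constant. The space $\mathcal{L}_\alpha$ is the set of $u:\mathbb{R}^n\to\mathbb{R}$ with $\int_{\mathbb{R}^n}\frac{|u(x)|}{1+|x|^{n+\alpha}}\,dx<\infty$. $B_{\lambda_0}(0)\subset\mathbb{R}^n$ is the open ball of radius $\lambda_0$ centred at the origin and $B_{\lambda_0}^c(0)$ is its complement in $\mathbb{R}^n$. Inequalities for $(-\Delta)^{\alpha/2}h$ are pointwise. *)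

theory Defs
  imports "HOL-Analysis.Analysis"
begin

text \<open>
  The fractional Laplacian \<open>(-\<Delta>)\<^bsup>\<alpha>/2\<^esup> u(x)\<close> with normalization constant \<open>C\<close>. The principal value is
  the limit, as \<open>\<epsilon>\<close> decreases to \<open>0\<close>, of the integrals over the complements of the balls
  \<open>B\<^sub>\<epsilon>(x)\<close>. If that limit does not exist, \<^const>\<open>Lim\<close> returns an unspecified real; for \<open>0 < \<alpha> < 2\<close>,
  \<open>u\<close> in \<open>L_alpha \<alpha>\<close> and of class \<open>C\<^sup>1\<^sup>,\<^sup>1\<close> near \<open>x\<close>, it exists.
\<close>
definition frac_laplacian :: "real \<Rightarrow> real \<Rightarrow> (real ^ 'n \<Rightarrow> real) \<Rightarrow> real ^ 'n \<Rightarrow> real" where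
  "frac_laplacian C \<alpha> u x =
     C * Lim (at_right 0)
       (\<lambda>\<epsilon>. LINT z : - ball x \<epsilon> | lebesgue.
              (u x - u z) / norm (x - z) powr (real CARD('n) + \<alpha>))"

text \<open>Measurability is part of the definition: without it, \<open>\<integral>\<^sup>+\<close> would be a lower integral.\<close>
definition L_alpha :: "real \<Rightarrow> (real ^ 'n \<Rightarrow> real) set" where
  "L_alpha \<alpha> =
     {u. u \<in> borel_measurable lebesgue \<and>
         (\<integral>\<^sup>+ x. ennreal (\<bar>u x\<bar> / (1 + norm x powr (real CARD('n) + \<alpha>))) \<partial>lebesgue) < \<infinity>}"

text \<open>Functions that are differentiable on the open set \<open>\<Omega>\<close> with locally Lipschitz gradient \<open>g\<close>.\<close>
definition C11_loc :: "('a::real_inner) set \<Rightarrow> ('a \<Rightarrow> real) set" where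
  "C11_loc \<Omega> =
     {u. \<exists>g. (\<forall>x\<in>\<Omega>. GDERIV u x :> g x) \<and>
             (\<forall>x\<in>\<Omega>. \<exists>r>0. \<exists>L. L-lipschitz_on (ball x r \<inter> \<Omega>) g)}"

definition lower_semicontinuous_on :: "('a::topological_space) set \<Rightarrow> ('a \<Rightarrow> real) \<Rightarrow> bool" where
  "lower_semicontinuous_on S u \<longleftrightarrow>
     (\<forall>x\<in>S. \<forall>a<u x. \<forall>\<^sub>F y in at x within S. a < u y)"

end

theory Submission
  imports Defs
begin

text \<open>
  Suppose \<open>h\<close> is negative somewhere in \<open>\<Omega>\<close>. It is nonnegative off \<open>\<Omega>\<close> outside the ball, it is lower
  semicontinuous on the closure of \<open>\<Omega>\<close>, and its lower limit at infinity is nonnegative; so the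
  infimum of \<open>h\<close> over the exterior of the ball is attained at some \<open>x\<close> in \<open>\<Omega>\<close> with \<open>h x < 0\<close>, and the
  contradiction is that \<open>(-\<Delta>)\<^bsup>\<alpha>/2\<^esup> h(x) < 0\<close>.

  The gradient of \<open>h\<close> vanishes at \<open>x\<close> and is locally Lipschitz, so \<open>h x - h z\<close> is of quadratic
  order near \<open>x\<close>, and the integrand \<open>(h x - h z) / norm (x - z) powr (n + \<alpha>)\<close> is absolutely integrable
  (\<open>frac_laplacian_integrand_integrable\<close>). Hence the principal value is a Lebesgue integral over the
  whole space. The integrand has the right sign outside the ball but not inside, where nothing
  is known about the sign of \<open>h x - h z\<close>. The part inside is therefore moved outside by the inversion
  \<open>y \<mapsto> (R\<^sup>2 / (norm y)\<^sup>2) *\<^sub>R y\<close>, whose Jacobian is \<open>(R / norm y) ^ (2 * n)\<close> (\<open>integral_inversion\<close>),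
  and each outer point \<open>y\<close> is paired with its reflection.

  Antisymmetry expresses \<open>h\<close> at the reflection through \<open>h y\<close>, and the kernel at the reflection,
  after rescaling, is strictly smaller than the kernel at \<open>y\<close> (\<open>norm_diff_inversion\<close>). The sum of
  the two contributions is then at most a positive multiple of \<open>h x\<close>, hence negative
  (\<open>kelvin_paired_integrand_neg\<close>), and so is the integral.
\<close>

section \<open>Integrability of powers of the distance\<close>

text \<open>
  On the annulus the integrand is comparable to \<open>a powr s\<close>. The factor \<open>2 powr \<bar>s\<bar>\<close> absorbs the
  variation of the power over the annulus for either sign of \<open>s\<close>.
\<close>
lemma nn_integral_powr_annulus_le:
  fixes x :: "'a::euclidean_space" and s a :: real
  assumes "0 < a"
  shows "(\<integral>\<^sup>+z. ennreal (norm (x - z) powr s) * indicator (ball x (2*a) - ball x a) z \<partial>lborel)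
     \<le> ennreal (unit_ball_vol DIM('a) * 2 ^ DIM('a) * 2 powr \<bar>s\<bar> * a powr (DIM('a) + s))"
proof -
  have le: "norm (x - z) powr s \<le> 2 powr \<bar>s\<bar> * a powr s" if "z \<in> ball x (2*a) - ball x a" for z
  proof -
    have z: "a \<le> norm (x - z)" "norm (x - z) \<le> 2 * a" using that by (auto simp: dist_norm)
    show ?thesis
    proof (cases "s \<ge> 0")
      case True
      have "norm (x - z) powr s \<le> (2 * a) powr s" using z True by (intro powr_mono2) auto
      then show ?thesis using True assms by (simp add: powr_mult)
    next
      case False
      have "norm (x - z) powr s \<le> a powr s" using z False assms by (intro powr_mono2') auto
      also have "\<dots> \<le> 2 powr \<bar>s\<bar> * a powr s" using ge_one_powr_ge_zero[of 2 "\<bar>s\<bar>"] by (simp add: mult_le_cancel_right1)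
      finally show ?thesis .
    qed
  qed
  have "(\<integral>\<^sup>+z. ennreal (norm (x - z) powr s) * indicator (ball x (2*a) - ball x a) z \<partial>lborel)
     \<le> (\<integral>\<^sup>+z. ennreal (2 powr \<bar>s\<bar> * a powr s) * indicator (ball x (2*a)) z \<partial>lborel)"
    using le by (intro nn_integral_mono) (auto simp: indicator_def intro!: ennreal_leI)
  also have "\<dots> = ennreal (2 powr \<bar>s\<bar> * a powr s) * emeasure lborel (ball x (2*a))"
    by (subst nn_integral_cmult_indicator) auto
  also have "\<dots> = ennreal (2 powr \<bar>s\<bar> * a powr s * (unit_ball_vol DIM('a) * (2 * a) ^ DIM('a)))"
    using assms by (simp add: emeasure_ball ennreal_mult'')
  also have "\<dots> = ennreal (unit_ball_vol DIM('a) * 2 ^ DIM('a) * 2 powr \<bar>s\<bar> * a powr (DIM('a) + s))"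
    using assms by (simp add: powr_add powr_realpow power_mult_distrib mult_ac)
  finally show ?thesis .
qed

text \<open>
  Annuli of radii \<open>a * q ^ k\<close> contribute a geometric series with ratio \<open>q powr (DIM('a) + s)\<close>. Taking
  \<open>q = 1/2\<close> exhausts a punctured ball, and \<open>q = 2\<close> exhausts the complement of a ball.
\<close>
lemma nn_integral_powr_dyadic_finite:
  fixes x :: "'a::euclidean_space" and s a q :: real
  assumes "0 < a" "0 < q" "q powr (DIM('a) + s) < 1"
    and cov: "S - {x} \<subseteq> (\<Union>k. ball x (2 * (a * q ^ k)) - ball x (a * q ^ k))"
  shows "(\<integral>\<^sup>+z. ennreal (norm (x - z) powr s) * indicator S z \<partial>lborel) < \<infinity>"
proof -
  let ?A = "\<lambda>k. ball x (2 * (a * q ^ k)) - ball x (a * q ^ k)"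
  define c where "c = unit_ball_vol DIM('a) * 2 ^ DIM('a) * 2 powr \<bar>s\<bar> * a powr (DIM('a) + s)"
  have "c \<ge> 0" unfolding c_def by (intro mult_nonneg_nonneg) auto
  have "(\<integral>\<^sup>+z. ennreal (norm (x - z) powr s) * indicator S z \<partial>lborel)
     \<le> (\<integral>\<^sup>+z. (\<Sum>k. ennreal (norm (x - z) powr s) * indicator (?A k) z) \<partial>lborel)"
  proof (intro nn_integral_mono)
    fix z
    \<comment> \<open>The centre lies in no annulus, but there the integrand is \<open>0 powr s = 0\<close>.\<close>
    show "ennreal (norm (x - z) powr s) * indicator S z \<le> (\<Sum>k. ennreal (norm (x - z) powr s) * indicator (?A k) z)"
    proof (cases "z \<in> S - {x}")
      case True
      then obtain k where "z \<in> ?A k" using cov by blast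
      then have "ennreal (norm (x - z) powr s) * indicator S z \<le> (\<Sum>i\<in>{k}. ennreal (norm (x - z) powr s) * indicator (?A i) z)"
        using True by simp
      also have "\<dots> \<le> (\<Sum>k. ennreal (norm (x - z) powr s) * indicator (?A k) z)"
        by (intro sum_le_suminf) auto
      finally show ?thesis .
    qed auto
  qed
  also have "\<dots> = (\<Sum>k. \<integral>\<^sup>+z. ennreal (norm (x - z) powr s) * indicator (?A k) z \<partial>lborel)"
  proof (intro nn_integral_suminf)
    fix k
    have [measurable]: "?A k \<in> sets borel" by auto
    show "(\<lambda>z. ennreal (norm (x - z) powr s) * indicator (?A k) z) \<in> borel_measurable lborel"
      by measurable
  qed
  also have "\<dots> \<le> (\<Sum>k. ennreal (c * (q powr (DIM('a) + s)) ^ k))"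
  proof (intro suminf_le)
    fix k
    have "(\<integral>\<^sup>+z. ennreal (norm (x - z) powr s) * indicator (?A k) z \<partial>lborel)
      \<le> ennreal (unit_ball_vol DIM('a) * 2 ^ DIM('a) * 2 powr \<bar>s\<bar> * (a * q ^ k) powr (DIM('a) + s))"
      using assms by (intro nn_integral_powr_annulus_le) auto
    also have "(a * q ^ k) powr (DIM('a) + s) = a powr (DIM('a) + s) * (q powr (DIM('a) + s)) ^ k"
      using assms by (simp add: powr_mult powr_powr mult.commute flip: powr_realpow)
    finally show "(\<integral>\<^sup>+z. ennreal (norm (x - z) powr s) * indicator (?A k) z \<partial>lborel)
      \<le> ennreal (c * (q powr (DIM('a) + s)) ^ k)" by (simp add: c_def mult_ac)
  qed auto
  also have "\<dots> < \<infinity>"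
    using \<open>c \<ge> 0\<close> assms(2,3) by (subst suminf_ennreal2) (auto intro!: summable_mult summable_geometric)
  finally show ?thesis .
qed

lemma nn_integral_powr_near_finite:
  fixes x :: "'a::euclidean_space" and s r :: real
  assumes "0 < r" "- real DIM('a) < s"
  shows "(\<integral>\<^sup>+z. ennreal (norm (x - z) powr s) * indicator (ball x r) z \<partial>lborel) < \<infinity>"
proof (rule nn_integral_powr_dyadic_finite[where a = "r/2" and q = "1/2"])
  show "(1/2) powr (DIM('a) + s) < 1"
    using assms powr_less_mono'[of "1/2" 0 "DIM('a) + s"] by simp
  show "ball x r - {x} \<subseteq> (\<Union>k. ball x (2 * (r / 2 * (1 / 2) ^ k)) - ball x (r / 2 * (1 / 2) ^ k))"
  proof
    fix z assume z: "z \<in> ball x r - {x}"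
    define P where "P k \<longleftrightarrow> r * (1/2) ^ k \<le> dist x z" for k :: nat
    obtain k where "(1/2) ^ k < dist x z / r" using z assms real_arch_pow_inv[of "dist x z / r" "1/2"] by auto
    then have "P k" using assms by (simp add: P_def field_simps)
    moreover have "\<not> P 0" using z by (simp add: P_def)
    ultimately obtain m where "\<not> P m" "P (Suc m)" using ex_least_nat_less[of P k] by auto
    then show "z \<in> (\<Union>k. ball x (2 * (r / 2 * (1 / 2) ^ k)) - ball x (r / 2 * (1 / 2) ^ k))"
      by (intro UN_I[of m]) (simp_all add: P_def not_le)
  qed
qed (use assms in auto)

lemma nn_integral_powr_far_finite:
  fixes x :: "'a::euclidean_space" and s r :: real
  assumes "0 < r" "s < - real DIM('a)"
  shows "(\<integral>\<^sup>+z. ennreal (norm (x - z) powr s) * indicator (- ball x r) z \<partial>lborel) < \<infinity>"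
proof (rule nn_integral_powr_dyadic_finite[where a = r and q = "2"])
  show "2 powr (DIM('a) + s) < 1"
    using assms powr_less_mono[of "DIM('a) + s" 0 2] by simp
  show "- ball x r - {x} \<subseteq> (\<Union>k. ball x (2 * (r * 2 ^ k)) - ball x (r * 2 ^ k))"
  proof
    fix z assume z: "z \<in> - ball x r - {x}"
    define P where "P k \<longleftrightarrow> dist x z < r * 2 ^ k" for k :: nat
    obtain k where "dist x z / r < 2 ^ k" using real_arch_pow[of 2 "dist x z / r"] by auto
    then have "P k" using assms by (simp add: P_def field_simps)
    moreover have "\<not> P 0" using z by (simp add: P_def)
    ultimately obtain m where "\<not> P m" "P (Suc m)" using ex_least_nat_less[of P k] by auto
    then show "z \<in> (\<Union>k. ball x (2 * (r * 2 ^ k)) - ball x (r * 2 ^ k))"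
      by (intro UN_I[of m]) (simp_all add: P_def not_less)
  qed
qed (use assms in auto)

section \<open>Change of variables under the inversion in a sphere\<close>

definition inversion :: "real \<Rightarrow> 'a::real_inner \<Rightarrow> 'a" where
  "inversion R x = (R\<^sup>2 / (norm x)\<^sup>2) *\<^sub>R x"

lemma norm_inversion: "norm (inversion R x) = R\<^sup>2 / norm x"
  by (cases "x = 0") (auto simp: inversion_def power2_eq_square)

lemma inversion_inversion: "R \<noteq> 0 \<Longrightarrow> x \<noteq> 0 \<Longrightarrow> inversion R (inversion R x) = x"
  unfolding inversion_def[of R "inversion R x"] norm_inversion
  by (simp add: inversion_def power2_eq_square)

text \<open>
  The derivative is a homothety composed with the reflection in the hyperplane orthogonal to \<open>x\<close>,
  which is why the Jacobian determinant is a pure power of \<open>R / norm x\<close>.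
\<close>
lemma has_derivative_inversion:
  assumes "x \<noteq> 0"
  shows "(inversion R has_derivative (\<lambda>v. (R\<^sup>2 / (norm x)\<^sup>2) *\<^sub>R (v - (2 * (x \<bullet> v) / (norm x)\<^sup>2) *\<^sub>R x))) (at x within S)"
proof -
  have eq: "inversion R = (\<lambda>x. (R\<^sup>2 / (x \<bullet> x)) *\<^sub>R x)" by (simp add: inversion_def fun_eq_iff power2_norm_eq_inner)
  show ?thesis unfolding eq power2_norm_eq_inner
    using assms
    by (auto intro!: derivative_eq_intros simp: fun_eq_iff algebra_simps inner_commute power2_eq_square divide_simps)
qed

lemma orthogonal_transformation_reflection:
  fixes x :: "real ^ 'n"
  assumes "x \<noteq> 0"
  shows "orthogonal_transformation (\<lambda>v. v - (2 * (x \<bullet> v) / (norm x)\<^sup>2) *\<^sub>R x)"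
  unfolding orthogonal_transformation_def power2_norm_eq_inner
  using assms
  by (auto simp: linear_iff algebra_simps inner_commute add_divide_distrib scaleR_add_left)

lemma abs_det_inversion:
  fixes x :: "real ^ 'n"
  assumes "x \<noteq> 0"
  shows "\<bar>det (matrix (\<lambda>v. (R\<^sup>2 / (norm x)\<^sup>2) *\<^sub>R (v - (2 * (x \<bullet> v) / (norm x)\<^sup>2) *\<^sub>R x)))\<bar>
    = (R\<^sup>2 / (norm x)\<^sup>2) ^ CARD('n)"
proof -
  let ?f = "\<lambda>v. v - (2 * (x \<bullet> v) / (norm x)\<^sup>2) *\<^sub>R x" and ?c = "R\<^sup>2 / (norm x)\<^sup>2"
  have o: "orthogonal_transformation ?f" by (rule orthogonal_transformation_reflection[OF assms])
  then have "linear ?f" by (simp add: orthogonal_transformation_linear)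
  have "matrix (\<lambda>v. ?c *\<^sub>R ?f v) = matrix ((*\<^sub>R) ?c) ** matrix ?f"
    using matrix_compose[OF \<open>linear ?f\<close>, of "(*\<^sub>R) ?c"] by (simp add: o_def linear_iff algebra_simps)
  moreover have "\<bar>det (matrix ?f)\<bar> = 1"
    using o det_orthogonal_matrix[of "matrix ?f"] by (auto simp: orthogonal_transformation_matrix)
  ultimately show ?thesis by (simp add: det_mul abs_mult)
qed


lemma inversion_image_exterior:
  assumes "R > 0"
  shows "inversion R ` (- cball 0 R) = ball (0 :: 'a::real_inner) R - {0}"
proof (intro equalityI subsetI)
  fix x :: 'a assume "x \<in> inversion R ` (- cball 0 R)"
  then obtain y where y: "R < norm y" "x = inversion R y" by (auto simp: not_le)
  then have "norm x = R\<^sup>2 / norm y" by (simp add: norm_inversion)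
  moreover have ny: "0 < norm y" using y assms by linarith
  have "0 < R\<^sup>2 / norm y" "R\<^sup>2 / norm y < R" using y ny assms
    by (simp_all add: divide_less_eq power2_eq_square)
  ultimately show "x \<in> ball 0 R - {0}" by auto
next
  fix x :: 'a assume x: "x \<in> ball 0 R - {0}"
  then have "R < R\<^sup>2 / norm x" using assms by (auto simp: field_simps power2_eq_square)
  then have "inversion R x \<in> - cball 0 R" by (simp add: norm_inversion)
  then show "x \<in> inversion R ` (- cball 0 R)"
    using x assms by (metis DiffE imageI inversion_inversion insertI1 less_numeral_extra(3))
qed

lemma inj_on_inversion: "R > 0 \<Longrightarrow> inj_on (inversion R) (- {0})"
  by (rule inj_on_inverseI[of _ "inversion R"]) (auto simp: inversion_inversion)

text \<open>
  The origin is missing from the image of the exterior of the ball under the inversion. It is a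
  null set, so the integral over the whole ball appears on the right.
\<close>
lemma integral_inversion_ordered:
  fixes f :: "real ^ ('m :: {finite, wellorder}) \<Rightarrow> real"
  assumes R: "R > 0" and f: "integrable lebesgue f"
  shows "integrable lebesgue (\<lambda>y. indicator (- cball 0 R) y * ((R\<^sup>2 / (norm y)\<^sup>2) ^ CARD('m) * f (inversion R y)))"
    and "(\<integral>y. indicator (- cball 0 R) y * ((R\<^sup>2 / (norm y)\<^sup>2) ^ CARD('m) * f (inversion R y)) \<partial>lebesgue)
       = (\<integral>x. indicator (ball 0 R) x * f x \<partial>lebesgue)"
proof -
  let ?S = "- cball 0 R :: (real ^ 'm::_) set" and ?J = "\<lambda>y :: real ^ 'm::_. (R\<^sup>2 / (norm y)\<^sup>2) ^ CARD('m)"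
  let ?D = "\<lambda>x v. (R\<^sup>2 / (norm x)\<^sup>2) *\<^sub>R (v - (2 * (x \<bullet> v) / (norm x)\<^sup>2) *\<^sub>R x)"
  have S: "?S \<in> sets lebesgue" "ball 0 R - {0} \<in> sets (lebesgue :: (real ^ 'm::_) measure)" by auto
  have ne: "x \<noteq> 0" if "x \<in> ?S" for x using that R by auto
  have fS: "f absolutely_integrable_on (ball 0 R - {0})"
    using integrable_mult_indicator[OF S(2) f] by (simp add: set_integrable_def)
  \<comment> \<open>The change of variables theorem concerns vector-valued functions; \<open>f\<close> is taken as \<open>real ^ 1\<close>-valued.\<close>
  have "(\<lambda>x. \<bar>det (matrix (?D x))\<bar> *\<^sub>R (vec (f (inversion R x)) :: real ^ 1)) absolutely_integrable_on ?S \<and>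
           integral ?S (\<lambda>x. \<bar>det (matrix (?D x))\<bar> *\<^sub>R (vec (f (inversion R x)) :: real ^ 1)) = vec b
     \<longleftrightarrow> (\<lambda>x. vec (f x) :: real ^ 1) absolutely_integrable_on (inversion R ` ?S) \<and>
         integral (inversion R ` ?S) (\<lambda>x. vec (f x)) = (vec b :: real ^ 1)" for b
    using S ne R by (intro has_absolute_integral_change_of_variables has_derivative_inversion
        inj_on_subset[OF inj_on_inversion]) auto
  then have cov: "(\<lambda>x. \<bar>det (matrix (?D x))\<bar> * f (inversion R x)) absolutely_integrable_on ?S \<and>
           integral ?S (\<lambda>x. \<bar>det (matrix (?D x))\<bar> * f (inversion R x)) = b
     \<longleftrightarrow> f absolutely_integrable_on (ball 0 R - {0}) \<and> integral (ball 0 R - {0}) f = b" for b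
    by (simp add: absolutely_integrable_on_1_iff integral_on_1_eq inversion_image_exterior[OF R])
  have D: "\<bar>det (matrix (?D x))\<bar> = ?J x" if "x \<in> ?S" for x
    using ne[OF that] by (rule abs_det_inversion)
  from cov[of "integral (ball 0 R - {0}) f"] fS
  have *: "(\<lambda>x. \<bar>det (matrix (?D x))\<bar> * f (inversion R x)) absolutely_integrable_on ?S"
    "integral ?S (\<lambda>x. \<bar>det (matrix (?D x))\<bar> * f (inversion R x)) = integral (ball 0 R - {0}) f"
    by auto
  have eq: "(\<lambda>x. indicator ?S x *\<^sub>R (\<bar>det (matrix (?D x))\<bar> * f (inversion R x)))
      = (\<lambda>x. indicator ?S x * (?J x * f (inversion R x)))"
    using D by (auto simp: fun_eq_iff indicator_def)
  show "integrable lebesgue (\<lambda>y. indicator ?S y * (?J y * f (inversion R y)))"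
    using *(1) unfolding set_integrable_def eq .
  have "(\<integral>y. indicator ?S y * (?J y * f (inversion R y)) \<partial>lebesgue) = integral (ball 0 R - {0}) f"
    using set_lebesgue_integral_eq_integral(2)[OF *(1)] *(2) unfolding set_lebesgue_integral_def eq by simp
  also have "\<dots> = (\<integral>x. indicator (ball 0 R - {0}) x * f x \<partial>lebesgue)"
    using set_lebesgue_integral_eq_integral(2)[OF fS] unfolding set_lebesgue_integral_def by simp
  also have "\<dots> = (\<integral>x. indicator (ball 0 R) x * f x \<partial>lebesgue)"
  proof (rule integral_cong_AE)
    have "AE x in lebesgue. x \<notin> {0 :: real ^ 'm::_}"
      by (intro AE_not_in) (simp flip: negligible_iff_null_sets)
    then show "AE x in lebesgue. indicator (ball 0 R - {0}) x * f x = indicator (ball 0 R) x * f x"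
      by eventually_elim (auto simp: indicator_def)
  qed (use f S in \<open>auto intro!: borel_measurable_times borel_measurable_indicator\<close>)
  finally show "(\<integral>y. indicator ?S y * (?J y * f (inversion R y)) \<partial>lebesgue) = (\<integral>x. indicator (ball 0 R) x * f x \<partial>lebesgue)" .
qed

text \<open>
  The change of variables theorem is formulated for coordinates that are indexed by a well-ordered
  finite type. A finite index type carries no canonical order, so the order is put on a copy of it,
  transported from the natural numbers along an enumeration; relabelling the coordinates is then a
  measure-preserving linear isometry.
\<close>
typedef 'a ordered_copy = "UNIV :: 'a set" ..

instance ordered_copy :: (finite) finite
  by standard (metis finite finite_imageI type_definition.Abs_image type_definition_ordered_copy)

instantiation ordered_copy :: (finite) linorder
begin
definition "a \<le> b \<longleftrightarrow> to_nat (Rep_ordered_copy a) \<le> to_nat (Rep_ordered_copy b)"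
definition "a < b \<longleftrightarrow> to_nat (Rep_ordered_copy a) < to_nat (Rep_ordered_copy b)"
instance
  by intro_classes (auto simp: less_eq_ordered_copy_def less_ordered_copy_def Rep_ordered_copy_inject)
end

instance ordered_copy :: (finite) wellorder
proof -
  have "wf {(x :: 'a ordered_copy, y). x < y}"
    by (auto simp: trancl_def tranclp_less intro!: finite_acyclic_wf acyclicI)
  then show "OFCLASS('a ordered_copy, wellorder_class)"
    by (rule wf_wellorderI) intro_classes
qed

definition relabel :: "real ^ ('n :: finite) \<Rightarrow> real ^ ('n ordered_copy)" where
  "relabel x = (\<chi> i. x $ Rep_ordered_copy i)"

definition unlabel :: "real ^ (('n :: finite) ordered_copy) \<Rightarrow> real ^ 'n" where
  "unlabel y = (\<chi> i. y $ Abs_ordered_copy i)"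

lemma unlabel_relabel [simp]: "unlabel (relabel x) = x"
  by (simp add: unlabel_def relabel_def vec_eq_iff Abs_ordered_copy_inverse)

lemma relabel_unlabel [simp]: "relabel (unlabel x) = x"
  by (simp add: unlabel_def relabel_def vec_eq_iff Rep_ordered_copy_inverse)

lemma bij_Rep_ordered_copy: "bij Rep_ordered_copy"
  by (metis Abs_ordered_copy_inverse Rep_ordered_copy_inverse UNIV_I bijI')

lemma norm_relabel [simp]: "norm (relabel x) = norm x"
  unfolding norm_vec_def L2_set_def relabel_def
  using sum.reindex_bij_betw[OF bij_Rep_ordered_copy, of "\<lambda>i. (norm (x $ i))\<^sup>2"] by simp

lemma norm_unlabel [simp]: "norm (unlabel x) = norm x"
  by (metis norm_relabel relabel_unlabel)

lemma linear_relabel: "linear relabel"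
  by (simp add: linear_iff relabel_def vec_eq_iff)

lemma linear_unlabel: "linear unlabel"
  by (simp add: linear_iff unlabel_def vec_eq_iff)

lemma relabel_borel [measurable]: "relabel \<in> borel_measurable borel"
  by (intro borel_measurable_continuous_onI linear_continuous_on linear_conv_bounded_linear[THEN iffD1] linear_relabel)

lemma unlabel_borel [measurable]: "unlabel \<in> borel_measurable borel"
  by (intro borel_measurable_continuous_onI linear_continuous_on linear_conv_bounded_linear[THEN iffD1] linear_unlabel)

lemma prod_Basis_cart:
  fixes x :: "real ^ 'm"
  shows "(\<Prod>b\<in>Basis. x \<bullet> b) = (\<Prod>i\<in>UNIV. x $ i)"
proof -
  have "bij_betw (\<lambda>i. axis i 1) UNIV (Basis :: (real ^ 'm) set)"
    by (auto simp: bij_betw_def Basis_vec_def inj_def axis_eq_axis)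
  from prod.reindex_bij_betw[OF this, of "\<lambda>b. x \<bullet> b"] show ?thesis
    by (simp add: inner_axis)
qed

lemma distr_lborel_relabel: "distr lborel borel relabel = (lborel :: (real ^ ('n :: finite) ordered_copy) measure)"
proof (rule lborel_eqI[symmetric])
  fix l u :: "real ^ 'n ordered_copy"
  assume le: "\<And>b. b \<in> Basis \<Longrightarrow> l \<bullet> b \<le> u \<bullet> b"
  have box: "relabel -` box l u = box (unlabel l) (unlabel u)"
    by (auto simp: mem_box_cart relabel_def unlabel_def) (metis Rep_ordered_copy_inverse Abs_ordered_copy_inverse UNIV_I)+
  have le': "unlabel l \<bullet> b \<le> unlabel u \<bullet> b" if "b \<in> Basis" for b
  proof -
    have "l $ i \<le> u $ i" for i using le[of "axis i 1"] by (simp add: inner_axis)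
    then show ?thesis using that by (auto simp: Basis_vec_def inner_axis unlabel_def)
  qed
  have "emeasure (distr lborel borel relabel) (box l u) = ennreal (\<Prod>b\<in>Basis. (unlabel u - unlabel l) \<bullet> b)"
    using le' by (subst emeasure_distr) (auto simp: box emeasure_lborel_box)
  also have "(\<Prod>b\<in>Basis. (unlabel u - unlabel l) \<bullet> b) = (\<Prod>i\<in>UNIV. (unlabel u - unlabel l) $ i)"
    by (rule prod_Basis_cart)
  also have "\<dots> = (\<Prod>i\<in>UNIV. (u - l) $ i)"
    using prod.reindex_bij_betw[OF bij_Rep_ordered_copy, of "\<lambda>i. (unlabel u - unlabel l) $ i"]
    by (simp add: unlabel_def Rep_ordered_copy_inverse)
  finally show "emeasure (distr lborel borel relabel) (box l u) = ennreal (\<Prod>b\<in>Basis. (u - l) \<bullet> b)"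
    by (simp add: prod_Basis_cart)
qed simp

lemma relabel_inversion: "relabel (inversion R x) = inversion R (relabel x)"
  using linear_cmul[OF linear_relabel] by (simp add: inversion_def)

lemma unlabel_inversion: "unlabel (inversion R x) = inversion R (unlabel x)"
  by (metis relabel_inversion relabel_unlabel unlabel_relabel)

lemma borel_measurable_inversion [measurable]: "inversion R \<in> borel_measurable (borel :: ('a::euclidean_space) measure)"
  unfolding inversion_def by measurable

text \<open>
  Relabelling coordinates commutes with the inversion and preserves Lebesgue measure, so the formula
  carries over to an arbitrary finite index type.
\<close>
lemma integral_inversion_borel:
  fixes f :: "real ^ 'n \<Rightarrow> real"
  assumes R: "R > 0" and f: "integrable lborel f"
  shows "integrable lborel (\<lambda>y. indicator (- cball 0 R) y * ((R\<^sup>2 / (norm y)\<^sup>2) ^ CARD('n) * f (inversion R y)))"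
    and "(\<integral>y. indicator (- cball 0 R) y * ((R\<^sup>2 / (norm y)\<^sup>2) ^ CARD('n) * f (inversion R y)) \<partial>lborel)
       = (\<integral>x. indicator (ball 0 R) x * f x \<partial>lborel)"
proof -
  have [measurable]: "f \<in> borel_measurable borel" using f by auto
  let ?f = "f \<circ> unlabel"
  have card: "CARD('n ordered_copy) = CARD('n)"
    by (metis bij_Rep_ordered_copy bij_betw_same_card)
  have f': "integrable lebesgue ?f"
    using integrable_distr_eq[of relabel lborel borel ?f] f
    by (simp add: distr_lborel_relabel integrable_completion o_def)
  have mem: "indicator (- cball 0 R) (unlabel y) = (indicator (- cball 0 R) y :: real)"
      "indicator (ball 0 R) (unlabel y) = (indicator (ball 0 R) y :: real)" for y :: "real ^ 'n ordered_copy"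
    by (auto simp: indicator_def)
  have transfer: "integrable lebesgue (\<lambda>y. k (unlabel y)) \<longleftrightarrow> integrable lborel k"
    "(\<integral>y. k (unlabel y) \<partial>lebesgue) = (\<integral>y. k y \<partial>lborel)"
    if [measurable]: "k \<in> borel_measurable borel" for k :: "real ^ 'n \<Rightarrow> real"
    using integrable_distr_eq[of relabel lborel borel "\<lambda>y. k (unlabel y)"]
      integral_distr[of relabel lborel borel "\<lambda>y. k (unlabel y)"]
    by (simp_all add: distr_lborel_relabel integrable_completion integral_completion)
  have [measurable]: "ball 0 R \<in> sets (borel :: (real ^ 'n) measure)" "- cball 0 R \<in> sets (borel :: (real ^ 'n) measure)" by auto
  let ?k = "\<lambda>y. indicator (- cball 0 R) y * ((R\<^sup>2 / (norm y)\<^sup>2) ^ CARD('n) * f (inversion R y))"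
  have [measurable]: "?k \<in> borel_measurable borel" "(\<lambda>x. indicator (ball 0 R) x * f x) \<in> borel_measurable borel"
    by measurable
  note * = integral_inversion_ordered[OF R f']
  show "integrable lborel ?k"
    using *(1) transfer(1)[of ?k] by (simp add: mem unlabel_inversion card o_def)
  show "(\<integral>y. ?k y \<partial>lborel) = (\<integral>x. indicator (ball 0 R) x * f x \<partial>lborel)"
    using *(2) transfer(2)[of ?k] transfer(2)[of "\<lambda>x. indicator (ball 0 R) x * f x"]
    by (simp add: mem unlabel_inversion card o_def)
qed

text \<open>
  A Lebesgue-integrable function agrees almost everywhere with a Borel one. Composition with the
  inversion respects this because the inversion is differentiable away from the origin and so maps
  null sets to null sets.
\<close>
lemma integral_inversion:
  fixes f :: "real ^ 'n \<Rightarrow> real"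
  assumes R: "R > 0" and f: "integrable lebesgue f"
  shows "integrable lebesgue (\<lambda>y. indicator (- cball 0 R) y * ((R\<^sup>2 / (norm y)\<^sup>2) ^ CARD('n) * f (inversion R y)))"
      (is "integrable lebesgue (?k f)")
    and "(\<integral>y. indicator (- cball 0 R) y * ((R\<^sup>2 / (norm y)\<^sup>2) ^ CARD('n) * f (inversion R y)) \<partial>lebesgue)
       = (\<integral>x. indicator (ball 0 R) x * f x \<partial>lebesgue)"
proof -
  obtain f' where f'[measurable]: "f' \<in> borel_measurable lborel" and ae: "AE x in lborel. f x = f' x"
    using completion_ex_borel_measurable_real[of f lborel] f by auto
  from ae obtain N where N: "{x. f x \<noteq> f' x} \<subseteq> N" "N \<in> null_sets lborel"
    by (auto elim!: AE_E simp: null_sets_def)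
  have ae': "AE x in lebesgue. f x = f' x" using ae by (rule AE_completion)
  have "integrable lebesgue f'"
    using f ae' integrable_cong_AE[of f lebesgue f'] by (auto simp: measurable_completion)
  then have int: "integrable lborel f'" by (simp add: integrable_completion)
  let ?N = "inversion R ` (N - {0})"
  have "negligible N" using N(2) by (simp add: negligible_iff_null_sets null_sets_completionI)
  then have "negligible ?N"
    by (intro negligible_differentiable_image_negligible)
       (auto simp: differentiable_on_def differentiable_def intro: has_derivative_inversion negligible_subset)
  then have "AE y in lebesgue. y \<notin> ?N" by (intro AE_not_in) (simp add: negligible_iff_null_sets)
  then have aek: "AE y in lebesgue. ?k f y = ?k f' y"
  proof eventually_elim
    fix y assume y: "y \<notin> ?N"
    show "?k f y = ?k f' y"
    proof (cases "y \<in> - cball 0 R")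
      case True
      then have "y \<noteq> 0" using R by auto
      then have "inversion R y \<noteq> 0" using R by (simp add: inversion_def)
      then have "inversion R y \<notin> N"
        using y \<open>y \<noteq> 0\<close> R by (metis DiffI image_eqI inversion_inversion less_numeral_extra(3) singletonD)
      then show ?thesis using N(1) by auto
    qed auto
  qed
  have ball_f: "integrable lebesgue (\<lambda>x. indicator (ball 0 R) x * f x)"
    using integrable_mult_indicator[OF _ f, of "ball 0 R"] by simp
  have ball_f': "integrable lborel (\<lambda>x. indicator (ball 0 R) x * f' x)"
    using integrable_mult_indicator[OF _ int, of "ball 0 R"] by simp
  note * = integral_inversion_borel[OF R int]
  have k'm: "?k f' \<in> borel_measurable lebesgue" using borel_measurable_integrable[OF *(1)] by (rule measurable_completion)
  have km: "?k f \<in> borel_measurable lebesgue"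
  proof (rule borel_measurable_AE[OF k'm])
    show "AE y in lebesgue. ?k f' y = ?k f y" using aek by eventually_elim (rule sym)
  qed
  show "integrable lebesgue (?k f)"
  proof (rule integrable_cong_AE[THEN iffD2, OF km k'm aek])
    show "integrable lebesgue (?k f')"
      using *(1) integrable_completion[OF borel_measurable_integrable[OF *(1)]] by (rule iffD2[rotated])
  qed
  have "(\<integral>y. ?k f y \<partial>lebesgue) = (\<integral>y. ?k f' y \<partial>lebesgue)"
    using aek km k'm by (intro integral_cong_AE)
  also have "\<dots> = (\<integral>x. indicator (ball 0 R) x * f' x \<partial>lborel)"
    unfolding *(2)[symmetric] by (rule integral_completion[OF borel_measurable_integrable[OF *(1)]])
  also have "\<dots> = (\<integral>x. indicator (ball 0 R) x * f' x \<partial>lebesgue)"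
    using borel_measurable_integrable[OF ball_f'] by (rule integral_completion[symmetric])
  also have "\<dots> = (\<integral>x. indicator (ball 0 R) x * f x \<partial>lebesgue)"
  proof (rule integral_cong_AE)
    show "AE x in lebesgue. indicator (ball 0 R) x * f' x = indicator (ball 0 R) x * f x"
      using ae' by eventually_elim simp
    show "(\<lambda>x. indicator (ball 0 R) x * f' x) \<in> borel_measurable lebesgue"
      using borel_measurable_integrable[OF ball_f'] by (rule measurable_completion)
    show "(\<lambda>x. indicator (ball 0 R) x * f x) \<in> borel_measurable lebesgue"
      using borel_measurable_integrable[OF ball_f] .
  qed
  finally show "(\<integral>y. ?k f y \<partial>lebesgue) = (\<integral>x. indicator (ball 0 R) x * f x \<partial>lebesgue)" .
qed

section \<open>The fractional Laplacian at a minimum\<close>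

text \<open>
  The gradient vanishes at the minimum, so by the Lipschitz condition it is at most \<open>L * dist x y\<close>
  on the ball of radius \<open>dist x y\<close> about \<open>x\<close>; the mean value inequality on that ball gives the bound.
\<close>
lemma C11_loc_quadratic_growth_at_min:
  fixes u :: "'a::real_inner \<Rightarrow> real"
  assumes "open \<Omega>" "u \<in> C11_loc \<Omega>" "x \<in> \<Omega>" "\<And>y. y \<in> \<Omega> \<Longrightarrow> u x \<le> u y"
  obtains r L where "r > 0" "L \<ge> 0" "\<And>y. y \<in> ball x r \<Longrightarrow> \<bar>u x - u y\<bar> \<le> L * (norm (x - y))\<^sup>2"
proof -
  obtain g where g: "\<And>y. y \<in> \<Omega> \<Longrightarrow> GDERIV u y :> g y"
    and "\<exists>r>0. \<exists>L. L-lipschitz_on (ball x r \<inter> \<Omega>) g"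
    using assms(2,3) unfolding C11_loc_def by blast
  then obtain r L where r: "r > 0" and L: "L-lipschitz_on (ball x r \<inter> \<Omega>) g" by blast
  obtain s where s: "s > 0" "ball x s \<subseteq> \<Omega>" using assms(1,3) by (auto simp: open_contains_ball)
  have "(\<lambda>v. v \<bullet> g x) = (\<lambda>v. 0)"
    using differential_zero_maxmin[OF assms(3,1), of u] g[OF assms(3)] assms(4) unfolding gderiv_def by blast
  then have "g x \<bullet> g x = 0" by metis
  then have g0: "g x = 0" by simp
  let ?r = "min r s"
  have "\<bar>u x - u y\<bar> \<le> L * (norm (x - y))\<^sup>2" if y: "y \<in> ball x ?r" for y
  proof -
    have sub: "cball x (dist x y) \<subseteq> ball x r \<inter> \<Omega>" using y s(2) by auto
    have "norm (u x - u y) \<le> (L * dist x y) * norm (x - y)"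
    proof (rule differentiable_bound[of "cball x (dist x y)" u "\<lambda>z v. v \<bullet> g z"])
      fix z assume z: "z \<in> cball x (dist x y)"
      have z': "z \<in> ball x r \<inter> \<Omega>" using z sub by blast
      then show "(u has_derivative (\<lambda>v. v \<bullet> g z)) (at z within cball x (dist x y))"
        using g[of z] by (auto simp: gderiv_def intro: has_derivative_at_withinI)
      have "norm (g z) \<le> L * dist x z"
        using lipschitz_onD[OF L _ z', of x] r assms(3) by (simp add: g0)
      also have "\<dots> \<le> L * dist x y" using lipschitz_on_nonneg[OF L] z by (intro mult_left_mono) auto
      finally have *: "norm (g z) \<le> L * dist x y" .
      show "onorm (\<lambda>v. v \<bullet> g z) \<le> L * dist x y"
      proof (rule onorm_bound)
        show "0 \<le> L * dist x y" using lipschitz_on_nonneg[OF L] by simp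
        show "norm (v \<bullet> g z) \<le> L * dist x y * norm v" for v
          using Cauchy_Schwarz_ineq2[of v "g z"] mult_left_mono[OF *, of "norm v"] by (simp add: mult_ac)
      qed
    qed auto
    then show ?thesis by (simp add: dist_norm power2_eq_square mult_ac)
  qed
  then show thesis using that[of ?r L] r s lipschitz_on_nonneg[OF L] by auto
qed

text \<open>
  Near \<open>x\<close> the quadratic bound leaves the singularity \<open>norm (x - z) powr (2 - n - \<alpha>)\<close>, which is
  integrable since \<open>\<alpha> < 2\<close>. Away from \<open>x\<close> the kernel is comparable to \<open>1 / (1 + norm z powr (n + \<alpha>))\<close>:
  the constant \<open>u x\<close> is then integrable since \<open>\<alpha> > 0\<close>, and \<open>u\<close> itself by membership in \<open>L_alpha\<close>.
\<close>
lemma frac_laplacian_integrand_integrable: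
  fixes u :: "real ^ 'n \<Rightarrow> real"
  assumes \<alpha>: "0 < \<alpha>" "\<alpha> < 2" and u: "u \<in> L_alpha \<alpha>" and "r > 0" "L \<ge> 0"
    and quad: "\<And>y. y \<in> ball x r \<Longrightarrow> \<bar>u x - u y\<bar> \<le> L * (norm (x - y))\<^sup>2"
  shows "integrable lebesgue (\<lambda>z. (u x - u z) / norm (x - z) powr (real CARD('n) + \<alpha>))"
proof -
  let ?p = "real CARD('n) + \<alpha>"
  let ?F = "\<lambda>z. (u x - u z) / norm (x - z) powr ?p"
  have [measurable]: "u \<in> borel_measurable lebesgue" using u by (simp add: L_alpha_def)
  have [measurable]: "(\<lambda>z. norm (x - z) powr s) \<in> borel_measurable lebesgue" "(\<lambda>z :: real ^ 'n. norm z powr s) \<in> borel_measurable lebesgue" for s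
    by (auto intro!: measurable_completion)
  \<comment> \<open>Off the ball, \<open>1\<close> and \<open>norm z\<close> are both bounded by multiples of \<open>norm (x - z)\<close>; the two summands
    of \<open>M\<close> are the \<open>?p\<close>-th powers of the two factors.\<close>
  define M where "M = r powr - ?p + (norm x / r + 1) powr ?p"
  have "M \<ge> 0" by (simp add: M_def)
  have M: "1 + norm z powr ?p \<le> M * norm (x - z) powr ?p" if "z \<notin> ball x r" for z
  proof -
    have r: "r \<le> norm (x - z)" using that by (simp add: dist_norm)
    have "1 = r powr - ?p * r powr ?p" using \<open>r > 0\<close> by (simp flip: powr_add)
    also have "\<dots> \<le> r powr - ?p * norm (x - z) powr ?p"
      using r \<open>r > 0\<close> \<alpha> by (intro mult_left_mono powr_mono2) auto
    finally have 1: "1 \<le> r powr - ?p * norm (x - z) powr ?p" .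
    have "norm x \<le> norm x / r * norm (x - z)" using mult_left_mono[OF r, of "norm x"] \<open>r > 0\<close> by (simp add: field_simps)
    then have "norm z \<le> (norm x / r + 1) * norm (x - z)"
      using norm_triangle_ineq4[of x "x - z"] by (simp add: algebra_simps)
    then have "norm z powr ?p \<le> ((norm x / r + 1) * norm (x - z)) powr ?p"
      using \<alpha> by (intro powr_mono2) auto
    also have "\<dots> = (norm x / r + 1) powr ?p * norm (x - z) powr ?p"
      using \<open>r > 0\<close> by (intro powr_mult)
    finally show ?thesis using 1 by (simp add: M_def algebra_simps)
  qed
  let ?N = "\<lambda>z. ennreal (norm (x - z) powr (2 - ?p)) * indicator (ball x r) z"
    and ?T = "\<lambda>z. ennreal (norm (x - z) powr - ?p) * indicator (- ball x r) z"
    and ?W = "\<lambda>z. ennreal (\<bar>u z\<bar> / (1 + norm z powr ?p))"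
  have bound: "ennreal (norm (?F z)) \<le> ennreal L * ?N z + (ennreal \<bar>u x\<bar> * ?T z + ennreal M * ?W z)" for z
  proof (cases "z \<in> ball x r")
    case True
    show ?thesis
    proof (cases "z = x")
      case False
      then have n: "norm (x - z) > 0" by simp
      have "norm (?F z) \<le> L * (norm (x - z))\<^sup>2 / norm (x - z) powr ?p"
        using quad[OF True] by (simp add: abs_divide divide_right_mono)
      also have "\<dots> = L * norm (x - z) powr (2 - ?p)"
        using n by (simp add: powr_diff)
      finally have "ennreal (norm (?F z)) \<le> ennreal L * ?N z"
        using True \<open>L \<ge> 0\<close> by (simp add: ennreal_leI flip: ennreal_mult)
      then show ?thesis by (simp add: add_increasing2)
    qed simp
  next
    case False
    then have n: "norm (x - z) > 0" using \<open>r > 0\<close> by auto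
    have pos: "0 < 1 + norm z powr ?p" using powr_ge_zero[of "norm z" ?p] by linarith
    have "norm (?F z) \<le> (\<bar>u x\<bar> + \<bar>u z\<bar>) / norm (x - z) powr ?p"
      by (simp add: abs_divide divide_right_mono)
    also have "\<dots> = \<bar>u x\<bar> * norm (x - z) powr - ?p + \<bar>u z\<bar> / norm (x - z) powr ?p"
      by (simp only: powr_minus_divide add_divide_distrib times_divide_eq_right mult_1_right)
    also have "\<bar>u z\<bar> / norm (x - z) powr ?p \<le> M * (\<bar>u z\<bar> / (1 + norm z powr ?p))"
      using mult_left_mono[OF M[OF False], of "\<bar>u z\<bar>"] n pos by (simp add: field_simps)
    finally have "ennreal (norm (?F z)) \<le> ennreal (\<bar>u x\<bar> * norm (x - z) powr - ?p + M * (\<bar>u z\<bar> / (1 + norm z powr ?p)))"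
      by (simp add: ennreal_leI)
    also have "\<dots> = ennreal \<bar>u x\<bar> * ?T z + ennreal M * ?W z"
    proof -
      have "ennreal (a * v + M * w) = ennreal a * ennreal v + ennreal M * ennreal w"
        if "0 \<le> a" "0 \<le> v" "0 \<le> w" for a v w :: real
        using that \<open>M \<ge> 0\<close> by (simp add: ennreal_plus ennreal_mult)
      from this[of "\<bar>u x\<bar>" "norm (x - z) powr - ?p" "\<bar>u z\<bar> / (1 + norm z powr ?p)"]
      show ?thesis using False pos by simp
    qed
    finally show ?thesis using False by simp
  qed
  have N: "(\<integral>\<^sup>+z. ?N z \<partial>lebesgue) < \<infinity>"
    using nn_integral_powr_near_finite[of r "2 - ?p" x] \<alpha> \<open>r > 0\<close> by (simp add: nn_integral_completion)
  have T: "(\<integral>\<^sup>+z. ?T z \<partial>lebesgue) < \<infinity>"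
    using nn_integral_powr_far_finite[of r "- ?p" x] \<alpha> \<open>r > 0\<close> by (simp add: nn_integral_completion)
  have W: "(\<integral>\<^sup>+z. ?W z \<partial>lebesgue) < \<infinity>"
    using u by (simp add: L_alpha_def)
  show ?thesis
  proof (rule integrableI_bounded)
    have [measurable]: "ball x r \<in> sets lebesgue" "- ball x r \<in> sets lebesgue" by auto
    have "(\<integral>\<^sup>+z. ennreal (norm (?F z)) \<partial>lebesgue)
       \<le> (\<integral>\<^sup>+z. ennreal L * ?N z + (ennreal \<bar>u x\<bar> * ?T z + ennreal M * ?W z) \<partial>lebesgue)"
      by (intro nn_integral_mono bound)
    also have "\<dots> = ennreal L * (\<integral>\<^sup>+z. ?N z \<partial>lebesgue)
        + (ennreal \<bar>u x\<bar> * (\<integral>\<^sup>+z. ?T z \<partial>lebesgue) + ennreal M * (\<integral>\<^sup>+z. ?W z \<partial>lebesgue))"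
      by (simp add: nn_integral_add nn_integral_cmult)
    also have "\<dots> < \<infinity>"
      using N T W by (simp add: ennreal_mult_less_top)
    finally show "(\<integral>\<^sup>+z. ennreal (norm (?F z)) \<partial>lebesgue) < \<infinity>" .
  qed measurable
qed

text \<open>
  When the integrand is absolutely integrable, the principal value is an ordinary integral, by
  dominated convergence.
\<close>
lemma frac_laplacian_eq_integral:
  fixes u :: "real ^ 'n \<Rightarrow> real"
  assumes int: "integrable lebesgue (\<lambda>z. (u x - u z) / norm (x - z) powr (real CARD('n) + \<alpha>))"
  shows "frac_laplacian C \<alpha> u x
    = C * (\<integral>z. (u x - u z) / norm (x - z) powr (real CARD('n) + \<alpha>) \<partial>lebesgue)"
proof -
  let ?F = "\<lambda>z. (u x - u z) / norm (x - z) powr (real CARD('n) + \<alpha>)"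
  have "((\<lambda>\<epsilon>. LINT z : - ball x \<epsilon> | lebesgue. ?F z) \<longlongrightarrow> (\<integral>z. ?F z \<partial>lebesgue)) (at_right 0)"
  proof (rule tendsto_at_right_sequentially[of 0 1])
    fix S :: "nat \<Rightarrow> real" assume S: "\<And>n. 0 < S n" "S \<longlonglongrightarrow> 0"
    show "(\<lambda>n. LINT z : - ball x (S n) | lebesgue. ?F z) \<longlonglongrightarrow> (\<integral>z. ?F z \<partial>lebesgue)"
      unfolding set_lebesgue_integral_def
    proof (rule integral_dominated_convergence[where w = "\<lambda>z. norm (?F z)"])
      show "?F \<in> borel_measurable lebesgue" using int by auto
      then show "(\<lambda>z. indicator (- ball x (S n)) z *\<^sub>R ?F z) \<in> borel_measurable lebesgue" for n
        by (intro borel_measurable_scaleR borel_measurable_indicator) auto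
      show "AE z in lebesgue. (\<lambda>n. indicator (- ball x (S n)) z *\<^sub>R ?F z) \<longlonglongrightarrow> ?F z"
      proof (rule AE_I2)
        fix z
        show "(\<lambda>n. indicator (- ball x (S n)) z *\<^sub>R ?F z) \<longlonglongrightarrow> ?F z"
        proof (cases "z = x")
          case False
          then have "\<forall>\<^sub>F n in sequentially. S n < dist x z"
            using order_tendstoD(2)[OF S(2), of "dist x z"] by simp
          then have "\<forall>\<^sub>F n in sequentially. indicator (- ball x (S n)) z *\<^sub>R ?F z = ?F z"
            by eventually_elim auto
          then show ?thesis by (rule tendsto_eventually)
        qed simp
      qed
      show "AE z in lebesgue. norm (indicator (- ball x (S n)) z *\<^sub>R ?F z) \<le> norm (?F z)" for n
        by (intro AE_I2) (auto simp: indicator_def)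
    qed (use int in \<open>rule integrable_norm\<close>)
  qed simp
  then have "Lim (at_right 0) (\<lambda>\<epsilon>. LINT z : - ball x \<epsilon> | lebesgue. ?F z) = (\<integral>z. ?F z \<partial>lebesgue)"
    by (intro tendsto_Lim) auto
  then show ?thesis by (simp add: frac_laplacian_def)
qed

section \<open>The maximum principle for Kelvin-antisymmetric functions\<close>

lemma lower_semicontinuous_on_attains_inf:
  assumes "lower_semicontinuous_on T u" "K \<subseteq> T" "compact K" "K \<noteq> {}"
  obtains x where "x \<in> K" "\<And>y. y \<in> K \<Longrightarrow> u x \<le> u y"
proof -
  have "\<exists>x\<in>K. \<forall>y\<in>K. u x \<le> u y"
  proof (rule ccontr)
    assume "\<not> ?thesis"
    \<comment> \<open>The strict superlevel sets of the values \<open>u (b x)\<close> cover \<open>K\<close>; the least value of a finite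
      subcover is itself attained at a point of \<open>K\<close>, which some member of the subcover contains.\<close>
    then have "\<forall>x\<in>K. \<exists>y\<in>K. u y < u x" by (auto simp: not_le)
    then obtain b where b: "\<And>x. x \<in> K \<Longrightarrow> b x \<in> K \<and> u (b x) < u x" by metis
    have "\<exists>U. open U \<and> x \<in> U \<and> (\<forall>y\<in>U \<inter> K. u (b x) < u y)" if x: "x \<in> K" for x
    proof -
      have "\<forall>\<^sub>F y in at x within T. u (b x) < u y"
        using assms(1,2) x b[OF x] by (auto simp: lower_semicontinuous_on_def)
      then obtain U where "open U" "x \<in> U" "\<forall>y\<in>U. y \<noteq> x \<longrightarrow> y \<in> T \<longrightarrow> u (b x) < u y"
        unfolding eventually_at_topological by auto
      then show ?thesis using assms(2) b[OF x] by (metis IntD1 IntD2 subsetD)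
    qed
    then obtain U where U: "\<And>x. x \<in> K \<Longrightarrow> open (U x) \<and> x \<in> U x \<and> (\<forall>y\<in>U x \<inter> K. u (b x) < u y)"
      by metis
    then obtain D where D: "D \<subseteq> K" "finite D" "K \<subseteq> (\<Union>x\<in>D. U x)"
      using compactE_image[OF assms(3), of K U] by (metis UN_I subsetI)
    then have "D \<noteq> {}" using assms(4) by auto
    then have "Min ((\<lambda>x. u (b x)) ` D) \<in> (\<lambda>x. u (b x)) ` D" using D by (intro Min_in) auto
    then obtain x where x: "x \<in> D" "u (b x) = Min ((\<lambda>x. u (b x)) ` D)" by auto
    then have "b x \<in> K" using D b by auto
    then obtain z where z: "z \<in> D" "b x \<in> U z" using D by auto
    then have "u (b z) < u (b x)" using U D \<open>b x \<in> K\<close> by auto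
    moreover have "u (b x) \<le> u (b z)" unfolding x(2) using z D by (intro Min_le) auto
    ultimately show False by simp
  qed
  then show thesis using that by blast
qed

text \<open>
  The left-hand side is the distance from \<open>x\<close> to the reflected point \<open>inversion R y\<close>, rescaled so as
  to be symmetric in \<open>x\<close> and \<open>y\<close>. If both points lie outside the sphere, the last term is positive:
  the reflected point is, after rescaling, farther from \<open>x\<close> than \<open>y\<close> is.
\<close>
lemma norm_diff_inversion:
  fixes x y :: "'a::real_inner"
  assumes "R > 0" "y \<noteq> 0"
  shows "(norm y / R * norm (x - inversion R y))\<^sup>2
    = (norm (x - y))\<^sup>2 + ((norm x)\<^sup>2 - R\<^sup>2) * ((norm y)\<^sup>2 - R\<^sup>2) / R\<^sup>2"
proof -
  have y2: "(norm y)\<^sup>2 \<noteq> 0" using assms by simp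
  have scale: "b * N = a * b - 2 * Q * c + Q * Q \<Longrightarrow> Q \<noteq> 0 \<Longrightarrow>
      b / Q * N = (a - 2 * c + b) + (a - Q) * (b - Q) / Q" for a b c N Q :: real
    by (simp add: field_simps)
  have "(norm (x - inversion R y))\<^sup>2 = (norm x)\<^sup>2 - 2 * (R\<^sup>2 / (norm y)\<^sup>2) * (x \<bullet> y) + (R\<^sup>2 / (norm y)\<^sup>2)\<^sup>2 * (norm y)\<^sup>2"
    unfolding inversion_def power2_norm_eq_inner by (simp add: inner_diff inner_commute algebra_simps power2_eq_square)
  also have "(R\<^sup>2 / (norm y)\<^sup>2)\<^sup>2 * (norm y)\<^sup>2 = R\<^sup>2 * R\<^sup>2 / (norm y)\<^sup>2"
  proof -
    have "(q / b)\<^sup>2 * b = q * q / b" if "b \<noteq> 0" for q b :: real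
      using that by (simp add: power2_eq_square)
    from this[OF y2] show ?thesis .
  qed
  finally have N: "(norm (x - inversion R y))\<^sup>2 = (norm x)\<^sup>2 - 2 * (R\<^sup>2 / (norm y)\<^sup>2) * (x \<bullet> y) + R\<^sup>2 * R\<^sup>2 / (norm y)\<^sup>2" .
  have "(norm y)\<^sup>2 * (norm (x - inversion R y))\<^sup>2 = (norm x)\<^sup>2 * (norm y)\<^sup>2 - 2 * R\<^sup>2 * (x \<bullet> y) + R\<^sup>2 * R\<^sup>2"
  proof -
    have "N = a - 2 * (Q / b) * c + Q * Q / b \<Longrightarrow> b \<noteq> 0 \<Longrightarrow> b * N = a * b - 2 * Q * c + Q * Q"
      for a b c N Q :: real by (simp add: field_simps)
    from this[OF N y2] show ?thesis .
  qed
  moreover have "(norm (x - y))\<^sup>2 = (norm x)\<^sup>2 - 2 * (x \<bullet> y) + (norm y)\<^sup>2"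
    unfolding power2_norm_eq_inner by (simp add: inner_diff inner_commute)
  ultimately show ?thesis
    using scale[of "(norm y)\<^sup>2" _ "(norm x)\<^sup>2" "R\<^sup>2" "x \<bullet> y"] assms(1)
    by (simp add: power_mult_distrib power_divide)
qed

text \<open>
  Write \<open>t = norm y / R\<close>, and let \<open>D\<close> be the rescaled distance of \<open>norm_diff_inversion\<close>. By the antisymmetry
  of \<open>h\<close>, the contribution of the reflected point is \<open>(t powr (\<alpha> - n) * h x + h y) / D powr (n + \<alpha>)\<close>.
  Since \<open>h x - h y\<close> is nonpositive and \<open>norm (x - y) < D\<close>, replacing \<open>norm (x - y)\<close> by \<open>D\<close> in the
  first term only increases it. Then \<open>h y\<close> cancels, and a positive multiple of \<open>h x\<close> remains.
\<close>
lemma kelvin_paired_integrand_neg: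
  fixes h :: "real ^ 'n \<Rightarrow> real"
  assumes R: "R > 0" and x: "norm x > R" and y: "norm y > R"
    and \<alpha>: "0 < \<alpha>"
    and neg: "h x < 0" and le: "h x \<le> h y"
    and anti: "h y = - ((R / norm y) powr (real CARD('n) - \<alpha>)) * h (inversion R y)"
  shows "(h x - h y) / norm (x - y) powr (real CARD('n) + \<alpha>)
    + (R\<^sup>2 / (norm y)\<^sup>2) ^ CARD('n)
      * ((h x - h (inversion R y)) / norm (x - inversion R y) powr (real CARD('n) + \<alpha>)) < 0"
proof -
  let ?n = "real CARD('n)"
  define t where "t = norm y / R"
  define D where "D = t * norm (x - inversion R y)"
  have "y \<noteq> 0" using R y by auto
  then have t: "t > 0" using R by (simp add: t_def)
  have "D\<^sup>2 = (norm (x - y))\<^sup>2 + ((norm x)\<^sup>2 - R\<^sup>2) * ((norm y)\<^sup>2 - R\<^sup>2) / R\<^sup>2"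
    unfolding D_def t_def by (rule norm_diff_inversion) fact+
  moreover have "((norm x)\<^sup>2 - R\<^sup>2) * ((norm y)\<^sup>2 - R\<^sup>2) / R\<^sup>2 > 0"
    using x y R by (intro divide_pos_pos mult_pos_pos) (auto intro: power_strict_mono)
  ultimately have D2: "(norm (x - y))\<^sup>2 < D\<^sup>2" by simp
  moreover have "D \<ge> 0" using t by (simp add: D_def)
  ultimately have D: "norm (x - y) < D" by (rule power_less_imp_less_base)
  then have D0: "D > 0" using norm_ge_zero[of "x - y"] by linarith
  have hg: "h (inversion R y) = - (t powr (?n - \<alpha>)) * h y"
  proof -
    have "t powr (?n - \<alpha>) * (R / norm y) powr (?n - \<alpha>) = (t * (R / norm y)) powr (?n - \<alpha>)"
      by (simp only: powr_mult)
    also have "\<dots> = 1" using R \<open>y \<noteq> 0\<close> by (simp add: t_def)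
    finally show ?thesis unfolding anti by simp
  qed
  have J: "(R\<^sup>2 / (norm y)\<^sup>2) ^ CARD('n) = t powr (- 2 * ?n)"
  proof -
    have "R\<^sup>2 / (norm y)\<^sup>2 = t powr (- 2)" using R t \<open>y \<noteq> 0\<close>
      by (simp add: t_def powr_minus powr_numeral power_divide)
    then show ?thesis using t by (simp add: powr_powr flip: powr_realpow)
  qed
  have "norm (x - inversion R y) powr (?n + \<alpha>) = (D / t) powr (?n + \<alpha>)" using t by (simp add: D_def)
  also have "\<dots> = D powr (?n + \<alpha>) / t powr (?n + \<alpha>)" using D0 t by (simp add: powr_divide)
  finally have "(R\<^sup>2 / (norm y)\<^sup>2) ^ CARD('n) * ((h x - h (inversion R y)) / norm (x - inversion R y) powr (?n + \<alpha>))
     = (t powr (- 2 * ?n) * t powr (?n + \<alpha>)) * (h x + t powr (?n - \<alpha>) * h y) / D powr (?n + \<alpha>)"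
    unfolding J hg by simp
  also have "t powr (- 2 * ?n) * t powr (?n + \<alpha>) = t powr - (?n - \<alpha>)" by (simp flip: powr_add)
  also have "t powr - (?n - \<alpha>) * (h x + t powr (?n - \<alpha>) * h y) = t powr - (?n - \<alpha>) * h x + h y"
  proof -
    have "t powr - (?n - \<alpha>) * t powr (?n - \<alpha>) = 1" using t by (simp flip: powr_add)
    then show ?thesis by (simp only: distrib_left mult.assoc[symmetric] mult_1_left)
  qed
  finally have inner: "(R\<^sup>2 / (norm y)\<^sup>2) ^ CARD('n) * ((h x - h (inversion R y)) / norm (x - inversion R y) powr (?n + \<alpha>))
     = (t powr - (?n - \<alpha>) * h x + h y) / D powr (?n + \<alpha>)" .
  have outer: "(h x - h y) / norm (x - y) powr (?n + \<alpha>) \<le> (h x - h y) / D powr (?n + \<alpha>)"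
    \<comment> \<open>On the diagonal the left-hand side is \<open>0 / 0 = 0\<close>, and so is the numerator on the right.\<close>
  proof (cases "x = y")
    case False
    then have "norm (x - y) powr (?n + \<alpha>) \<le> D powr (?n + \<alpha>)" "0 < norm (x - y) powr (?n + \<alpha>)"
      using D \<alpha> by (auto intro: powr_mono2)
    then show ?thesis using le D0 by (intro divide_left_mono_neg) (auto intro: mult_pos_pos)
  qed simp
  have "(h x - h y) / D powr (?n + \<alpha>) + (t powr - (?n - \<alpha>) * h x + h y) / D powr (?n + \<alpha>)
     = h x * (1 + t powr - (?n - \<alpha>)) / D powr (?n + \<alpha>)"
    by (simp add: algebra_simps flip: add_divide_distrib)
  also have "\<dots> < 0" using neg D0 by (intro divide_neg_pos mult_neg_pos) (auto intro: add_pos_nonneg)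
  finally show ?thesis using inner outer by linarith
qed

text \<open>
  Folding the ball onto its exterior by the inversion turns the integral over the whole space into
  the integral over the exterior of the paired integrand, which is negative there.
\<close>
lemma frac_laplacian_neg_at_negative_min:
  fixes h :: "real ^ 'n \<Rightarrow> real"
  assumes "R > 0" "norm x > R" "0 < \<alpha>" "C > 0"
    and int: "integrable lebesgue (\<lambda>z. (h x - h z) / norm (x - z) powr (real CARD('n) + \<alpha>))"
    and neg: "h x < 0" and min: "\<And>y. norm y > R \<Longrightarrow> h x \<le> h y"
    and anti: "\<And>y. norm y > R \<Longrightarrow> h y = - ((R / norm y) powr (real CARD('n) - \<alpha>)) * h (inversion R y)"
  shows "frac_laplacian C \<alpha> h x < 0"
proof -
  let ?F = "\<lambda>z. (h x - h z) / norm (x - z) powr (real CARD('n) + \<alpha>)"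
  let ?E = "- cball 0 R :: (real ^ 'n) set"
  let ?k = "\<lambda>y. indicator ?E y * ((R\<^sup>2 / (norm y)\<^sup>2) ^ CARD('n) * ?F (inversion R y))"
  let ?G = "\<lambda>y. indicator ?E y * ?F y + ?k y"
  note inv = integral_inversion[OF \<open>R > 0\<close> int]
  have intE: "integrable lebesgue (\<lambda>y. indicator ?E y * ?F y)"
    and intB: "integrable lebesgue (\<lambda>y. indicator (ball 0 R) y * ?F y)"
    using integrable_mult_indicator[OF _ int] by auto
  have intG: "integrable lebesgue ?G" using intE inv(1) by (rule Bochner_Integration.integrable_add)
  have G: "?G y < 0" if "y \<in> ?E" for y
    using kelvin_paired_integrand_neg[of R x y \<alpha> h] that assms by (simp add: not_le)
  have G0: "?G y \<le> 0" for y using G[of y] by (cases "y \<in> ?E") auto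
  have "(\<integral>z. ?F z \<partial>lebesgue) = (\<integral>z. indicator ?E z * ?F z + indicator (ball 0 R) z * ?F z \<partial>lebesgue)"
  proof (rule integral_cong_AE)
    have "negligible (sphere (0 :: real ^ 'n) R)" by (rule negligible_sphere)
    then have "AE z in lebesgue. z \<notin> sphere (0 :: real ^ 'n) R"
      by (intro AE_not_in) (simp add: negligible_iff_null_sets)
    then show "AE z in lebesgue. ?F z = indicator ?E z * ?F z + indicator (ball 0 R) z * ?F z"
      by eventually_elim (auto simp: indicator_def)
  qed (use int intE intB in auto)
  also have "\<dots> = (\<integral>z. ?G z \<partial>lebesgue)"
    using intE intB inv by (simp add: Bochner_Integration.integral_add)
  finally have eq: "(\<integral>z. ?F z \<partial>lebesgue) = (\<integral>z. ?G z \<partial>lebesgue)" .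
  have "(\<integral>z. ?G z \<partial>lebesgue) \<noteq> 0"
  proof
    assume "(\<integral>z. ?G z \<partial>lebesgue) = 0"
    then have "(\<integral>z. - ?G z \<partial>lebesgue) = 0" by (simp only: Bochner_Integration.integral_minus minus_zero)
    moreover have "integrable lebesgue (\<lambda>z. - ?G z)" using intG by (rule Bochner_Integration.integrable_minus)
    moreover have "AE z in lebesgue. 0 \<le> - ?G z" using G0 by (intro AE_I2) (simp only: neg_0_le_iff_le)
    ultimately have "AE z in lebesgue. - ?G z = 0" using integral_nonneg_eq_0_iff_AE by blast
    then have "AE z in lebesgue. z \<notin> ?E"
    proof eventually_elim
      fix z assume "- ?G z = 0"
      then show "z \<notin> ?E" using G[of z] by (metis less_irrefl neg_equal_0_iff_equal)
    qed
    then have "?E \<in> null_sets lebesgue" by (subst (asm) AE_iff_null_sets[symmetric]) auto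
    then have "negligible ?E" by (simp add: negligible_iff_null_sets)
    moreover have "open ?E" "x \<in> ?E" using assms by auto
    ultimately show False using open_not_negligible[of ?E] by blast
  qed
  moreover have "(\<integral>z. ?G z \<partial>lebesgue) \<le> 0"
  proof -
    have "0 \<le> (\<integral>z. - ?G z \<partial>lebesgue)"
      using G0 by (intro Bochner_Integration.integral_nonneg) (simp only: neg_0_le_iff_le)
    then show ?thesis by (simp only: Bochner_Integration.integral_minus neg_0_le_iff_le)
  qed
  ultimately show ?thesis
    using frac_laplacian_eq_integral[OF int] eq \<open>C > 0\<close> by (simp add: mult_pos_neg)
qed

theorem theorem1p2:
  fixes \<alpha> C lam0 :: real
    and \<Omega> :: "(real ^ 'n) set"
    and h :: "real ^ 'n \<Rightarrow> real"
  assumes "0 < \<alpha>" and "\<alpha> < 2"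
    and "real CARD('n) > \<alpha>"
    and "C > 0"
    and "lam0 > 0"
    and "open \<Omega>" and "\<Omega> \<subseteq> - ball 0 lam0"
    and "h \<in> L_alpha \<alpha> \<inter> C11_loc \<Omega>"
    and "lower_semicontinuous_on (closure \<Omega>) h"
    and "\<forall>x\<in>\<Omega>. frac_laplacian C \<alpha> h x \<ge> 0"
    and "\<forall>x\<in>- ball 0 lam0 - \<Omega>. h x \<ge> 0"
    and "\<forall>x\<in>- ball 0 lam0.
           h x = - ((lam0 / norm x) powr (real CARD('n) - \<alpha>))
                   * h ((lam0\<^sup>2 / (norm x)\<^sup>2) *\<^sub>R x)"
    and "Liminf at_infinity (\<lambda>x. ereal (h x)) \<ge> 0"
  shows "\<forall>x\<in>\<Omega>. h x \<ge> 0"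
proof (rule ccontr)
  assume "\<not> (\<forall>x\<in>\<Omega>. h x \<ge> 0)"
  then obtain x1 where x1: "x1 \<in> \<Omega>" "h x1 < 0" by (auto simp: not_le)
  have "ereal (h x1) < 0" using x1(2) by simp
  then have "ereal (h x1) < Liminf at_infinity (\<lambda>x. ereal (h x))"
    using assms(13) by (rule less_le_trans)
  then have "\<forall>\<^sub>F x in at_infinity. ereal (h x1) < ereal (h x)" by (rule less_LiminfD)
  then obtain b where b: "\<And>x. b \<le> norm x \<Longrightarrow> h x1 < h x" by (auto simp: eventually_at_infinity)
  \<comment> \<open>Beyond radius \<open>b\<close> the values of \<open>h\<close> exceed \<open>h x1\<close>, and off \<open>\<Omega>\<close> they are nonnegative, so a minimum
    over \<open>K\<close> is a minimum over the whole exterior of the ball.\<close>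
  define K where "K = closure \<Omega> \<inter> cball 0 (max b (norm x1))"
  have "x1 \<in> K" using x1 closure_subset[of \<Omega>] by (auto simp: K_def)
  then have "compact K" "K \<noteq> {}" "K \<subseteq> closure \<Omega>" by (auto simp: K_def)
  then obtain x where x: "x \<in> K" and xK: "\<And>y. y \<in> K \<Longrightarrow> h x \<le> h y"
    using lower_semicontinuous_on_attains_inf[OF assms(9)] by metis
  have hx: "h x \<le> h x1" "h x < 0" using xK[OF \<open>x1 \<in> K\<close>] x1 by auto
  have "closure \<Omega> \<subseteq> - ball 0 lam0" using assms(7) by (intro closure_minimal) auto
  then have "x \<in> - ball 0 lam0" using x by (auto simp: K_def)
  then have "x \<in> \<Omega>" using assms(11) hx(2) by (auto simp: not_le[symmetric])
  have min: "h x \<le> h y" if "y \<in> - ball 0 lam0" for y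
  proof (cases "y \<in> \<Omega>")
    case True
    then show ?thesis
      using xK[of y] b[of y] hx closure_subset[of \<Omega>] by (cases "b \<le> norm y") (auto simp: K_def)
  next
    case False
    then show ?thesis using assms(11) that hx by force
  qed
  have anti: "h y = - ((lam0 / norm y) powr (real CARD('n) - \<alpha>)) * h (inversion lam0 y)"
    if "y \<in> - ball 0 lam0" for y
    using assms(12) that unfolding inversion_def by blast
  \<comment> \<open>The sphere is fixed by the inversion, so \<open>h\<close> vanishes on it.\<close>
  have "norm x \<noteq> lam0"
  proof
    assume "norm x = lam0"
    then have "h x = - h x" using anti[OF \<open>x \<in> - ball 0 lam0\<close>] \<open>lam0 > 0\<close> by (simp add: inversion_def)
    then show False using hx by simp
  qed
  then have nx: "norm x > lam0" using \<open>x \<in> - ball 0 lam0\<close> by auto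
  obtain r L where "r > 0" "L \<ge> 0" "\<And>y. y \<in> ball x r \<Longrightarrow> \<bar>h x - h y\<bar> \<le> L * (norm (x - y))\<^sup>2"
    using C11_loc_quadratic_growth_at_min[OF assms(6) _ \<open>x \<in> \<Omega>\<close>, of h] assms(7,8) min by blast
  then have int: "integrable lebesgue (\<lambda>z. (h x - h z) / norm (x - z) powr (real CARD('n) + \<alpha>))"
    using frac_laplacian_integrand_integrable[of \<alpha> h r L x] assms by blast
  have "frac_laplacian C \<alpha> h x < 0"
  proof (rule frac_laplacian_neg_at_negative_min[where h = h, OF \<open>lam0 > 0\<close> nx \<open>0 < \<alpha>\<close> \<open>C > 0\<close> int hx(2)])
    fix y :: "real ^ 'n" assume "norm y > lam0"
    then have y: "y \<in> - ball 0 lam0" by simp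
    show "h x \<le> h y" using y by (rule min)
    show "h y = - ((lam0 / norm y) powr (real CARD('n) - \<alpha>)) * h (inversion lam0 y)"
      using y by (rule anti)
  qed
  then show False using assms(10) \<open>x \<in> \<Omega>\<close> by (simp add: not_le[symmetric])
qed

end
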